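(* Let $0<a<\infty$. Let $A$ be the discrete Laplacian of the C60 fullerene buckyball, with eigenvalues $0=\lambda_0<\lambda_1\le\cdots\le\lambda_{59}$ counted with multiplicity, let $E(a,\cdot)$ be the associated Sobolev energy, and let $G(a)=(A+aI)^{-1}$. There exists a constant $C>0$ such that for every $u={}^t(u(0),\dots,u(59))\in\mathbb{C}^{60}$ the discrete Sobolev inequality $$\left(\max_{0\le j\le 59}|u(j)|\right)^2\le C\,E(a,u)$$ holds (with $C$ independent of $u$). Among all such $C$, the best (smallest) constant is $C(a)=\dfrac{N(a)}{D(a)}$, where $$\begin{aligned}N(a)={}&3344+160806a+1153562a^2+3594661a^3+6334271a^4+7104785a^5+5406109a^6\\&+2893077a^7+1109403a^8+306415a^9+60463a^{10}+8315a^{11}+757a^{12}+41a^{13}+a^{14},\end{aligned}$$ $$\begin{aligned}D(a)={}&a(2+a)(5+a)(3+5a+a^2)(8+7a+a^2)(11+7a+a^2)(19+9a+a^2)\\&\times(4+22a+25a^2+9a^3+a^4).\end{aligned}$$ All the diagonal entries of $G(a)$ are equal to $C(a)$; in particular $$C(a)=\frac{1}{60}\sum_{j=0}^{59}\frac{1}{\lambda_j+a}.$$ If $C$ is replaced by $C(a)$ in the discrete Sobolev inequality $\left(\max_{0\le j\le 59}|u(j)|\right)^2\le C\,E(a,u)$, then equality holds for every column vector $u$ of $G(a)$.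
   Context: The C60 fullerene buckyball is the graph of the truncated icosahedron (60 vertices, 90 edges, 12 pentagonal and 20 hexagonal faces; every vertex has degree 3). Concretely, its vertices are the ordered pairs $(v,w)$ of adjacent vertices of the icosahedron graph; $(v,w)$ is adjacent to $(w,v)$, and $(v,w)$ is adjacent to $(v,w')$ whenever $w,w'$ are adjacent in the icosahedron graph; there are no other edges. The 60 vertices are labeled by the integers $0,1,\dots,59$, and $e$ denotes the set of (undirected) edges, each edge counted once. The discrete Laplacian is the $60\times 60$ real symmetric positive-semidefinite matrix $A=(a(i,j))_{0\le i,j\le 59}$ with $a(i,j)=3$ if $i=j$, $a(i,j)=-1$ if $(i,j)\in e$, and $a(i,j)=0$ otherwise. For $u={}^t(u(0),\dots,u(59))\in\mathbb{C}^{60}$ and $0<a<\infty$, the Sobolev energy is $E(a,u)=\sum_{(i,j)\in e}|u(i)-u(j)|^2+a\sum_{j=0}^{59}|u(j)|^2=u^*(A+aI)u$, where $I$ is the $60\times 60$ identity matrix. The matrix $G(a)=(A+aI)^{-1}$ is called the Green matrix of $A$. *)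

theory Defs
  imports
    Complex_Main
    "HOL-Library.Multiset"
    "HOL-Computational_Algebra.Polynomial"
    "Jordan_Normal_Form.Matrix"
    "Jordan_Normal_Form.Gauss_Jordan_Elimination"
    "Jordan_Normal_Form.Char_Poly"
begin

text \<open>
  The icosahedron is seen as two poles 0 and 11, an upper ring 1, ..., 5 around 0 and a lower
  ring 6, ..., 10 around 11. The last two lines are the zigzag of edges between the rings.
\<close>

definition icosahedron_edges :: "nat set set" where
  "icosahedron_edges =
     {{0,1}, {0,2}, {0,3}, {0,4}, {0,5},
      {1,2}, {2,3}, {3,4}, {4,5}, {5,1},
      {11,6}, {11,7}, {11,8}, {11,9}, {11,10},
      {6,7}, {7,8}, {8,9}, {9,10}, {10,6},
      {1,6}, {2,7}, {3,8}, {4,9}, {5,10},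
      {1,7}, {2,8}, {3,9}, {4,10}, {5,6}}"

definition icosahedron_adj :: "nat \<Rightarrow> nat \<Rightarrow> bool" where
  "icosahedron_adj v w \<longleftrightarrow> {v, w} \<in> icosahedron_edges"

definition buckyball_vertices :: "(nat \<times> nat) set" where
  "buckyball_vertices = {(v, w). icosahedron_adj v w}"

definition buckyball_adj :: "nat \<times> nat \<Rightarrow> nat \<times> nat \<Rightarrow> bool" where
  "buckyball_adj p q \<longleftrightarrow>
     p \<in> buckyball_vertices \<and> q \<in> buckyball_vertices \<and>
     ((fst q = snd p \<and> snd q = fst p) \<or> (fst q = fst p \<and> icosahedron_adj (snd p) (snd q)))"

definition buckyball_labeling :: "(nat \<Rightarrow> nat \<times> nat) \<Rightarrow> bool" where
  "buckyball_labeling lab \<longleftrightarrow> bij_betw lab {0..59} buckyball_vertices"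

lemma icosahedron_adj_bound:
  assumes "icosahedron_adj v w" shows "v \<in> set [0..<12] \<and> w \<in> set [0..<12]"
  using assms by (auto simp: icosahedron_adj_def icosahedron_edges_def doubleton_eq_iff)

lemma card_buckyball_vertices: "card buckyball_vertices = 60"
proof -
  let ?L = "filter (\<lambda>(v, w). icosahedron_adj v w) (List.product [0..<12] [0..<12])"
  have "buckyball_vertices = set ?L"
    using icosahedron_adj_bound by (auto simp: buckyball_vertices_def)
  moreover have "distinct ?L"
    by (intro distinct_filter distinct_product) simp_all
  moreover have "length ?L = 60"
    by (simp add: upt_rec icosahedron_adj_def icosahedron_edges_def doubleton_eq_iff)
  ultimately show ?thesis
    by (metis distinct_card)
qed

lemma buckyball_labeling_exists: "\<exists>lab. buckyball_labeling lab"
proof -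
  have "finite buckyball_vertices"
    using card_buckyball_vertices by (intro card_ge_0_finite) simp
  then show ?thesis
    unfolding buckyball_labeling_def
    by (intro finite_same_card_bij) (simp_all add: card_buckyball_vertices)
qed

text \<open>Each undirected edge is represented once, by the pair of its labels in increasing order.\<close>

definition buckyball_edges :: "(nat \<Rightarrow> nat \<times> nat) \<Rightarrow> (nat \<times> nat) set" where
  "buckyball_edges lab = {(i, j). i < j \<and> j \<le> 59 \<and> buckyball_adj (lab i) (lab j)}"

definition laplacian :: "(nat \<Rightarrow> nat \<times> nat) \<Rightarrow> real mat" where
  "laplacian lab = mat 60 60 (\<lambda>(i, j).
     if i = j then 3
     else if (i, j) \<in> buckyball_edges lab \<or> (j, i) \<in> buckyball_edges lab then - 1
     else 0)"

definition shifted_laplacian :: "(nat \<Rightarrow> nat \<times> nat) \<Rightarrow> real \<Rightarrow> real mat" where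
  "shifted_laplacian lab a = laplacian lab + a \<cdot>\<^sub>m 1\<^sub>m 60"

definition sobolev_energy :: "(nat \<Rightarrow> nat \<times> nat) \<Rightarrow> real \<Rightarrow> complex vec \<Rightarrow> real" where
  "sobolev_energy lab a u =
     (\<Sum>(i, j)\<in>buckyball_edges lab. (cmod (u $ i - u $ j))\<^sup>2) + a * (\<Sum>j = 0..59. (cmod (u $ j))\<^sup>2)"

text \<open>
  For \<open>a > 0\<close> the option returned by \<open>mat_inverse\<close> is never \<open>None\<close>; the main theorem
  states that this matrix is a two-sided inverse.
\<close>

definition green_matrix :: "(nat \<Rightarrow> nat \<times> nat) \<Rightarrow> real \<Rightarrow> real mat" where
  "green_matrix lab a = the (mat_inverse (shifted_laplacian lab a))"

text \<open>
  The real eigenvalues in increasing order, repeated according to their multiplicity as roots of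
  the characteristic polynomial. A length equal to the dimension says that there are no others.
\<close>

definition eigenvalue_list :: "real mat \<Rightarrow> real list" where
  "eigenvalue_list M = sorted_list_of_multiset (proots (char_poly M))"

definition max_modulus :: "complex vec \<Rightarrow> real" where
  "max_modulus u = (MAX j\<in>{0..59}. cmod (u $ j))"

definition sobolev_inequality :: "(nat \<Rightarrow> nat \<times> nat) \<Rightarrow> real \<Rightarrow> real \<Rightarrow> bool" where
  "sobolev_inequality lab a C \<longleftrightarrow>
     (\<forall>u \<in> carrier_vec 60. (max_modulus u)\<^sup>2 \<le> C * sobolev_energy lab a u)"

definition best_num :: "real \<Rightarrow> real" where
  "best_num a =
     3344 + 160806 * a + 1153562 * a^2 + 3594661 * a^3 + 6334271 * a^4 + 7104785 * a^5
     + 5406109 * a^6 + 2893077 * a^7 + 1109403 * a^8 + 306415 * a^9 + 60463 * a^10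
     + 8315 * a^11 + 757 * a^12 + 41 * a^13 + a^14"

definition best_den :: "real \<Rightarrow> real" where
  "best_den a =
     a * (2 + a) * (5 + a) * (3 + 5 * a + a^2) * (8 + 7 * a + a^2) * (11 + 7 * a + a^2)
     * (19 + 9 * a + a^2) * (4 + 22 * a + 25 * a^2 + 9 * a^3 + a^4)"

definition best_const :: "real \<Rightarrow> real" where
  "best_const a = best_num a / best_den a"

end

theory Submission
  imports Defs
begin

text \<open>
  Write \<open>M = A + a I\<close> and \<open>G = M\<^sup>-\<^sup>1\<close>. Since \<open>u\<^sup>* M u\<close> is the Sobolev energy, \<open>G\<close> is the reproducing
  kernel of the energy inner product: the value \<open>u(k)\<close> is the inner product of \<open>u\<close> with the \<open>k\<close>-th
  column of \<open>G\<close>, and this column has energy \<open>G(k, k)\<close>. By Cauchy and Schwarz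
  \<open>\<bar>u(k)\<bar>\<^sup>2 \<le> G(k, k) E(a, u)\<close>, with equality for the column (\<open>real_sobolev\<close>,
  \<open>col_green_extremal\<close>). As the buckyball is vertex transitive, the diagonal of \<open>G\<close> is constant, and
  its value is the best constant.

  The value comes from an exact solution of the Poisson equation with a source at one vertex. A
  Horner scheme divides the polynomial \<open>best_den\<close> by the operator; the division leaves no
  remainder, and the entries of the partial quotients at the source are the coefficients of
  \<open>best_num\<close> (\<open>resolvent_numerators_solve\<close>, \<open>resolvent_numerators_den_coeffs\<close>).
  Three reflections of the icosahedron transport the solution to any other source (\<open>point_source_solvable_all\<close>).

  The eigenvalues enter through the trace. For a real symmetric matrix the characteristic
  polynomial splits over the reals, and the trace of the resolvent is its logarithmic derivative
  (\<open>symmetric_char_poly_splits\<close>, \<open>trace_shifted_inverse\<close>). This gives the mean of the numbers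
  \<open>1 / (\<lambda>\<^sub>j + a)\<close>, and it also shows that the eigenvalue 0 is simple: its multiplicity is the limit of
  \<open>60 a \<cdot> best_const a\<close> for \<open>a\<close> tending to 0, which is 1 (\<open>laplacian_eigenvalues\<close>).
\<close>

section \<open>Real symmetric matrices and the trace of the resolvent\<close>

text \<open>
  For an eigenvector \<open>v\<close> the number \<open>v\<^sup>* A v\<close> equals \<open>z \<bar>v\<bar>\<^sup>2\<close>, and symmetry of \<open>A\<close> makes it equal to
  its own conjugate.
\<close>

lemma symmetric_eigenvalue_real:
  fixes A :: "real mat"
  assumes A: "A \<in> carrier_mat n n"
    and symm: "\<And>i j. i < n \<Longrightarrow> j < n \<Longrightarrow> A $$ (i, j) = A $$ (j, i)"
    and "eigenvalue (map_mat complex_of_real A) z"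
  shows "z \<in> \<real>"
proof -
  obtain v where v: "v \<in> carrier_vec n" "v \<noteq> 0\<^sub>v n" "map_mat complex_of_real A *\<^sub>v v = z \<cdot>\<^sub>v v"
    using assms unfolding eigenvalue_def eigenvector_def by auto
  have row: "(\<Sum>j<n. of_real (A $$ (i, j)) * v $ j) = z * v $ i" if "i < n" for i
    using arg_cong[OF v(3), of "\<lambda>w. w $ i"] that A v(1)
    by (simp add: scalar_prod_def atLeast0LessThan)
  define S where "S = (\<Sum>i<n. \<Sum>j<n. cnj (v $ i) * of_real (A $$ (i, j)) * v $ j)"
  define N where "N = (\<Sum>i<n. (cmod (v $ i))\<^sup>2)"
  have "S = (\<Sum>i<n. cnj (v $ i) * (z * v $ i))"
    unfolding S_def by (intro sum.cong refl) (simp add: row[symmetric] sum_distrib_left mult.assoc)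
  also have "\<dots> = z * of_real N"
    by (simp add: N_def sum_distrib_left complex_norm_square mult_ac del: of_real_power)
  finally have SN: "S = z * of_real N" .
  have "cnj S = (\<Sum>i<n. \<Sum>j<n. v $ i * of_real (A $$ (i, j)) * cnj (v $ j))"
    by (simp add: S_def)
  also have "\<dots> = (\<Sum>j<n. \<Sum>i<n. v $ i * of_real (A $$ (i, j)) * cnj (v $ j))"
    by (rule sum.swap)
  also have "\<dots> = S"
    unfolding S_def by (intro sum.cong refl) (simp add: symm mult_ac)
  finally have "cnj z * of_real N = z * of_real N"
    using SN by (metis complex_cnj_complex_of_real complex_cnj_mult)
  moreover have "N \<noteq> 0"
  proof
    assume "N = 0"
    then have "v $ i = 0" if "i < n" for i
      using that by (simp add: N_def sum_nonneg_eq_0_iff)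
    then show False using v by (auto intro: eq_vecI)
  qed
  ultimately show ?thesis
    by (simp add: Reals_cnj_iff)
qed

text \<open>
  The characteristic polynomial splits over the complex numbers, and its roots there are real; the
  factorization therefore descends along the injective embedding of the reals.
  Hence the list of real eigenvalues is complete.
\<close>

lemma symmetric_char_poly_splits:
  fixes A :: "real mat"
  assumes A: "A \<in> carrier_mat n n"
    and symm: "\<And>i j. i < n \<Longrightarrow> j < n \<Longrightarrow> A $$ (i, j) = A $$ (j, i)"
  shows "\<exists>es. char_poly A = (\<Prod>e\<leftarrow>es. [:- e, 1:]) \<and> length es = n"
proof -
  interpret of_real_poly: map_poly_inj_comm_ring_hom "of_real :: real \<Rightarrow> complex" ..
  let ?A = "map_mat complex_of_real A"
  have cA: "?A \<in> carrier_mat n n" using A by simp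
  obtain zs where zs: "char_poly ?A = (\<Prod>z\<leftarrow>zs. [:- z, 1:])" "length zs = n"
    using char_poly_factorized[OF cA] by blast
  have "z \<in> \<real>" if "z \<in> set zs" for z
    using symmetric_eigenvalue_real[OF A symm] eigenvalue_root_char_poly[OF cA]
      linear_poly_root[OF that] zs by auto
  then have "map (\<lambda>e. complex_of_real (Re e)) zs = zs"
    by (simp add: map_idI)
  then have "zs = map of_real (map Re zs)"
    by (simp add: o_def)
  then obtain es where es: "zs = map of_real es" ..
  have "map_poly complex_of_real (char_poly A) = (\<Prod>z\<leftarrow>zs. [:- z, 1:])"
    by (simp add: of_real_hom.char_poly_hom[OF A, symmetric] zs)
  also have "\<dots> = map_poly complex_of_real (\<Prod>e\<leftarrow>es. [:- e, 1:])"
    by (simp add: es of_real_poly.hom_prod_list o_def map_poly_pCons)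
  finally have "char_poly A = (\<Prod>e\<leftarrow>es. [:- e, 1:])"
    by simp
  then show ?thesis using zs es by auto
qed

lemma proots_prod_linear_factors: "proots (\<Prod>e\<leftarrow>es. [:- e, 1:]) = mset (es :: real list)"
proof (induction es)
  case (Cons e es)
  have "(\<Prod>e\<leftarrow>es. [:- e, 1:]) \<noteq> 0" by (auto simp: prod_list_zero_iff)
  then show ?case by (simp add: proots_mult Cons del: mult_pCons_left)
qed simp

lemma poly_pderiv_prod_linear_factors:
  fixes es :: "real list"
  assumes "x \<notin> set es"
  shows "poly (pderiv (\<Prod>e\<leftarrow>es. [:- e, 1:])) x
       = poly (\<Prod>e\<leftarrow>es. [:- e, 1:]) x * (\<Sum>e\<leftarrow>es. 1 / (x - e))"
  using assms
  by (induction es) (simp_all add: pderiv_mult pderiv_pCons field_simps del: mult_pCons_left)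

text \<open>
  The trace of the resolvent is the logarithmic derivative of the characteristic polynomial \<open>p\<close>.
  By Cramer's rule the \<open>i\<close>-th diagonal entry of the inverse of \<open>M = A + a I\<close> is the minor of \<open>M\<close>
  at \<open>(i, i)\<close> divided by \<open>det M\<close>. Up to sign the minors are the values at \<open>- a\<close> of the
  characteristic polynomials of the principal submatrices of \<open>A\<close>, which add up to \<open>p'\<close>.
\<close>

lemma trace_shifted_inverse:
  fixes A B :: "real mat"
  assumes A: "A \<in> carrier_mat n n" and B: "B \<in> carrier_mat n n"
    and es: "char_poly A = (\<Prod>e\<leftarrow>es. [:- e, 1:])"
    and inv: "(A + a \<cdot>\<^sub>m 1\<^sub>m n) * B = 1\<^sub>m n"
  shows "(\<Sum>i<n. B $$ (i, i)) = (\<Sum>e\<leftarrow>es. 1 / (e + a))" and "- a \<notin> set es"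
proof -
  define M where "M = A + a \<cdot>\<^sub>m 1\<^sub>m n"
  have M: "M \<in> carrier_mat n n" using A by (simp add: M_def)
  have MB: "M * B = 1\<^sub>m n" using inv by (simp add: M_def)
  have "det M * det B = 1" using det_mult[OF M B] MB by simp
  then have d0: "det M \<noteq> 0" by auto
  have "adj_mat M = adj_mat M * (M * B)" using adj_mat(1)[OF M] by (simp add: MB)
  also have "\<dots> = (adj_mat M * M) * B"
    by (rule assoc_mult_mat[OF adj_mat(1)[OF M] M B, symmetric])
  also have "\<dots> = det M \<cdot>\<^sub>m B" using adj_mat[OF M] B mult_smult_assoc_mat[OF one_carrier_mat B] by simp
  finally have adj: "adj_mat M = det M \<cdot>\<^sub>m B" .
  have minor: "det (mat_delete M i i) = det M * B $$ (i, i)" if "i < n" for i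
    using arg_cong[OF adj, of "\<lambda>X. X $$ (i, i)"] that M B
    by (simp add: adj_mat_def cofactor_def)
  have p: "poly (char_poly A) (- a) = (-1) ^ n * det M"
  proof -
    have "- char_matrix A (- a) = (- 1) \<cdot>\<^sub>m M"
      using A by (intro eq_matI) (auto simp: char_matrix_def M_def)
    then show ?thesis using M by (simp add: char_poly_matrix[OF A])
  qed
  have p': "poly (char_poly (mat_delete A i i)) (- a) = - ((-1) ^ n * det M) * B $$ (i, i)" if "i < n" for i
  proof -
    have D: "mat_delete A i i \<in> carrier_mat (n - 1) (n - 1)"
      using A by (rule mat_delete_carrier)
    have "- char_matrix (mat_delete A i i) (- a) = (- 1) \<cdot>\<^sub>m mat_delete M i i"
      using A that by (intro eq_matI) (auto simp: char_matrix_def M_def mat_delete_def)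
    then have "poly (char_poly (mat_delete A i i)) (- a) = (-1) ^ (n - 1) * det (mat_delete M i i)"
      using M by (simp add: char_poly_matrix[OF D])
    also have "(-1) ^ (n - 1) = - ((-1 :: real) ^ n)"
      using that by (cases n) auto
    finally show ?thesis using minor[OF that] by simp
  qed
  show na: "- a \<notin> set es"
  proof
    assume "- a \<in> set es"
    from linear_poly_root[OF this] show False using p d0 es by simp
  qed
  have "poly (pderiv (char_poly A)) (- a) = - poly (char_poly A) (- a) * (\<Sum>i<n. B $$ (i, i))"
    by (simp add: pderiv_char_poly[OF A] poly_sum p' p sum_distrib_left sum_negf)
  moreover have "poly (char_poly A) (- a) \<noteq> 0" using p d0 by simp
  moreover have "poly (char_poly A) (- a) * (\<Sum>i<n. B $$ (i, i))
      = poly (char_poly A) (- a) * - (\<Sum>e\<leftarrow>es. 1 / (- a - e))"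
    using calculation(1) poly_pderiv_prod_linear_factors[OF na] es by simp
  ultimately have "(\<Sum>i<n. B $$ (i, i)) = - (\<Sum>e\<leftarrow>es. 1 / (- a - e))"
    by (metis mult_left_cancel)
  also have "\<dots> = (\<Sum>e\<leftarrow>es. 1 / (e + a))"
  proof (induction es)
    case (Cons e es)
    have "- (1 / (- a - e)) = 1 / (e + a)"
      by (metis add.commute minus_add_distrib minus_divide_right uminus_add_conv_diff diff_conv_add_uminus minus_minus)
    then show ?case using Cons by simp
  qed simp
  finally show "(\<Sum>i<n. B $$ (i, i)) = (\<Sum>e\<leftarrow>es. 1 / (e + a))" .
qed

section \<open>Adjacency in the buckyball\<close>

definition icosahedron_nbrs :: "nat \<Rightarrow> nat set" where
  "icosahedron_nbrs v = {w. icosahedron_adj v w}"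

lemma icosahedron_nbrs_table:
    "icosahedron_nbrs 0 = {1, 2, 3, 4, 5}"
    "icosahedron_nbrs 1 = {0, 2, 5, 6, 7}"
    "icosahedron_nbrs 2 = {0, 1, 3, 7, 8}"
    "icosahedron_nbrs 3 = {0, 2, 4, 8, 9}"
    "icosahedron_nbrs 4 = {0, 3, 5, 9, 10}"
    "icosahedron_nbrs 5 = {0, 1, 4, 6, 10}"
    "icosahedron_nbrs 6 = {1, 5, 7, 10, 11}"
    "icosahedron_nbrs 7 = {1, 2, 6, 8, 11}"
    "icosahedron_nbrs 8 = {2, 3, 7, 9, 11}"
    "icosahedron_nbrs 9 = {3, 4, 8, 10, 11}"
    "icosahedron_nbrs 10 = {4, 5, 6, 9, 11}"
    "icosahedron_nbrs 11 = {6, 7, 8, 9, 10}"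
  by (auto simp: icosahedron_nbrs_def icosahedron_adj_def icosahedron_edges_def doubleton_eq_iff)

lemma icosahedron_adj_sym: "icosahedron_adj v w \<longleftrightarrow> icosahedron_adj w v"
  by (simp add: icosahedron_adj_def insert_commute)

lemma icosahedron_adj_irrefl: "\<not> icosahedron_adj v v"
  by (auto simp: icosahedron_adj_def icosahedron_edges_def doubleton_eq_iff)

lemma buckyball_adj_sym: "buckyball_adj p q \<longleftrightarrow> buckyball_adj q p"
  using icosahedron_adj_sym by (auto simp: buckyball_adj_def)

lemma buckyball_adj_irrefl: "\<not> buckyball_adj p p"
  by (auto simp: buckyball_adj_def icosahedron_adj_irrefl buckyball_vertices_def)

text \<open>
  Besides \<open>(w, v)\<close>, the neighbours of \<open>(v, w)\<close> come from the two triangles of the icosahedron on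
  the edge \<open>vw\<close>: their third corners are the common neighbours of \<open>v\<close> and \<open>w\<close>.
\<close>

lemma buckyball_nbrs:
  assumes "icosahedron_adj v w"
  shows "{q. buckyball_adj (v, w) q} = insert (w, v) (Pair v ` (icosahedron_nbrs v \<inter> icosahedron_nbrs w))"
  using assms icosahedron_adj_sym
  by (auto simp: buckyball_adj_def buckyball_vertices_def icosahedron_nbrs_def)

text \<open>
  A concrete numbering of the 60 vertices, used to represent integer functions on the vertices by
  lists. The five vertices with a common first component are consecutive in the list, in the cyclic
  order of their pentagonal face.
\<close>

definition vertex_list :: "(nat \<times> nat) list" where
  "vertex_list =
    [(0, 1), (0, 2), (0, 3), (0, 4), (0, 5), (1, 0), (1, 2), (1, 7), (1, 6), (1, 5), (2, 0),
     (2, 1), (2, 7), (2, 8), (2, 3), (3, 0), (3, 2), (3, 8), (3, 9), (3, 4), (4, 0), (4, 3),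
     (4, 9), (4, 10), (4, 5), (5, 0), (5, 1), (5, 6), (5, 10), (5, 4), (6, 1), (6, 5), (6, 10),
     (6, 11), (6, 7), (7, 1), (7, 2), (7, 8), (7, 11), (7, 6), (8, 2), (8, 3), (8, 9), (8, 11),
     (8, 7), (9, 3), (9, 4), (9, 10), (9, 11), (9, 8), (10, 4), (10, 5), (10, 6), (10, 11),
     (10, 9), (11, 6), (11, 7), (11, 8), (11, 9), (11, 10)]"

text \<open>
  The three neighbours of each vertex, as positions in the list above; first the one with the two
  components exchanged, then the two on the same pentagon.
\<close>

definition nbr_list :: "(nat \<times> nat \<times> nat) list" where
  "nbr_list =
    [(5, 1, 4), (10, 0, 2), (15, 1, 3), (20, 2, 4), (25, 0, 3), (0, 6, 9), (11, 5, 7),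
     (35, 6, 8), (30, 9, 7), (26, 5, 8), (1, 11, 14), (6, 10, 12), (36, 11, 13), (40, 14, 12),
     (16, 10, 13), (2, 16, 19), (14, 15, 17), (41, 16, 18), (45, 19, 17), (21, 15, 18),
     (3, 21, 24), (19, 20, 22), (46, 21, 23), (50, 24, 22), (29, 20, 23), (4, 26, 29),
     (9, 25, 27), (31, 26, 28), (51, 29, 27), (24, 25, 28), (8, 31, 34), (27, 30, 32),
     (52, 31, 33), (55, 34, 32), (39, 30, 33), (7, 36, 39), (12, 35, 37), (44, 36, 38),
     (56, 39, 37), (34, 35, 38), (13, 41, 44), (17, 40, 42), (49, 41, 43), (57, 44, 42),
     (37, 40, 43), (18, 46, 49), (22, 45, 47), (54, 46, 48), (58, 49, 47), (42, 45, 48),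
     (23, 51, 54), (28, 50, 52), (32, 51, 53), (59, 52, 54), (47, 50, 53), (33, 56, 59),
     (38, 55, 57), (43, 56, 58), (48, 57, 59), (53, 55, 58)]"

lemma length_lists: "length vertex_list = 60" "length nbr_list = 60"
  by (simp_all add: vertex_list_def nbr_list_def)

lemma distinct_vertex_list: "distinct vertex_list"
  by (simp add: vertex_list_def)

lemma set_vertex_list: "set vertex_list = buckyball_vertices"
proof (rule card_subset_eq)
  show "finite buckyball_vertices"
    using card_buckyball_vertices by (intro card_ge_0_finite) simp
  have "\<forall>(v, w)\<in>set vertex_list. w \<in> icosahedron_nbrs v"
    unfolding vertex_list_def by (simp add: icosahedron_nbrs_table del: One_nat_def)
  then show "set vertex_list \<subseteq> buckyball_vertices"
    by (auto simp: buckyball_vertices_def icosahedron_nbrs_def)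
  show "card (set vertex_list) = card buckyball_vertices"
    by (simp add: distinct_card distinct_vertex_list card_buckyball_vertices length_lists)
qed

lemma nbr_list_correct:
  "\<forall>k<60. case nbr_list ! k of (i, j, l) \<Rightarrow>
     {q. buckyball_adj (vertex_list ! k) q} = {vertex_list ! i, vertex_list ! j, vertex_list ! l}
     \<and> distinct [i, j, l] \<and> i < 60 \<and> j < 60 \<and> l < 60"
proof -
  have "list_all2 (\<lambda>(v, w) (i, j, l).
     insert (w, v) (Pair v ` (icosahedron_nbrs v \<inter> icosahedron_nbrs w))
       = {vertex_list ! i, vertex_list ! j, vertex_list ! l}
     \<and> distinct [i, j, l] \<and> i < 60 \<and> j < 60 \<and> l < 60) vertex_list nbr_list"
    unfolding nbr_list_def
    by (subst vertex_list_def)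
     (simp add: icosahedron_nbrs_table nth_Cons_numeral vertex_list_def del: One_nat_def)
  note table = this
  show ?thesis
  proof (intro allI impI)
    fix k :: nat assume k: "k < 60"
    obtain v w where vw: "vertex_list ! k = (v, w)" by fastforce
    have "(v, w) \<in> buckyball_vertices"
      using nth_mem[of k vertex_list] k length_lists set_vertex_list vw by simp
    then have "icosahedron_adj v w" by (simp add: buckyball_vertices_def)
    then show "case nbr_list ! k of (i, j, l) \<Rightarrow>
       {q. buckyball_adj (vertex_list ! k) q} = {vertex_list ! i, vertex_list ! j, vertex_list ! l}
       \<and> distinct [i, j, l] \<and> i < 60 \<and> j < 60 \<and> l < 60"
      using list_all2_nthD[OF table, of k] k by (simp add: length_lists vw buckyball_nbrs)
  qed
qed

section \<open>A Green function with polynomial entries\<close>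

definition neg_laplacian :: "int list \<Rightarrow> int list" where
  "neg_laplacian z = map2 (\<lambda>x (i, j, l). z ! i + z ! j + z ! l - 3 * x) z nbr_list"

definition source_list :: "int \<Rightarrow> int list" where
  "source_list d = d # replicate 59 0"

text \<open>
  Horner's scheme for the resolvent. Let \<open>L\<close> be the Laplacian, let \<open>e\<close> be the unit vector at the
  first vertex of the list, and let the argument be the list of coefficients of a polynomial
  \<open>d(a) = d\<^sub>0 + d\<^sub>1 a + \<dots> + d\<^sub>n a\<^sup>n\<close>. The result is \<open>[z\<^sub>-, z\<^sub>0, z\<^sub>1, \<dots>]\<close>, computed from the right
  by \<open>z\<^bsub>j-1\<^esub> = d\<^sub>j e - L z\<^sub>j\<close>; here \<open>z\<^sub>-\<close> is the last remainder, with index \<open>-1\<close>. Telescoping gives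
  \<open>(L + a I) (\<Sum>\<^sub>j a\<^sup>j z\<^sub>j) = d(a) e - z\<^sub>-\<close>, so a polynomial \<open>d\<close> for which \<open>z\<^sub>-\<close> vanishes is a
  denominator for the Green function with source \<open>e\<close>, and the \<open>z\<^sub>j\<close> are the coefficients of
  the numerator.
\<close>

fun resolvent_numerators :: "int list \<Rightarrow> int list list" where
  "resolvent_numerators [] = []"
| "resolvent_numerators (d # ds) = (case resolvent_numerators ds of
      [] \<Rightarrow> [source_list d]
    | z # zs \<Rightarrow> map2 (+) (source_list d) (neg_laplacian z) # z # zs)"

text \<open>
  The polynomials \<open>best_den\<close> and \<open>best_num\<close>, multiplied out.
\<close>

definition den_coeffs :: "int list" where
  "den_coeffs = [0, 200640, 1976648, 7629064, 16129912, 21457347,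
     19322452, 12286679, 5651656, 1901995, 468452, 83473, 10472, 877, 44, 1]"

definition num_coeffs :: "int list" where
  "num_coeffs = [3344, 160806, 1153562, 3594661, 6334271, 7104785,
     5406109, 2893077, 1109403, 306415, 60463, 8315, 757, 41, 1]"

text \<open>
  Up to sign of the variable, the denominator is the polynomial with the 15 distinct eigenvalues of
  the Laplacian as simple roots, hence its minimal polynomial. The first equation holds because this
  polynomial annihilates the Laplacian; both are verified by exact integer arithmetic.
\<close>

lemma resolvent_numerators_den_coeffs: "hd (resolvent_numerators den_coeffs) = replicate 60 0"
  "map hd (tl (resolvent_numerators den_coeffs)) = num_coeffs"
  by code_simp+

lemma resolvent_numerators_eq_Nil: "resolvent_numerators ds = [] \<longleftrightarrow> ds = []"
  by (cases ds) (auto split: list.split)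

lemma length_resolvent_numerators: "z \<in> set (resolvent_numerators ds) \<Longrightarrow> length z = 60"
  by (induction ds arbitrary: z)
    (auto simp: source_list_def neg_laplacian_def length_lists split: list.splits)

definition shifted_vertex_laplacian :: "real \<Rightarrow> (nat \<times> nat \<Rightarrow> real) \<Rightarrow> nat \<times> nat \<Rightarrow> real" where
  "shifted_vertex_laplacian a f p = (3 + a) * f p - (\<Sum>q | buckyball_adj p q. f q)"

definition column_value :: "int list list \<Rightarrow> real \<Rightarrow> nat \<Rightarrow> real" where
  "column_value zs a k = horner_sum of_int a (map (\<lambda>z. z ! k) zs)"

lemma column_value_simps [simp]:
  "column_value [] a k = 0" "column_value (z # zs) a k = of_int (z ! k) + a * column_value zs a k"
  by (simp_all add: column_value_def)

text \<open>
  The telescoping identity behind the scheme, at one vertex. In the induction step the tail of the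
  result grows from \<open>\<Sum>\<^sub>j a\<^sup>j z\<^sub>j\<close> to \<open>z + a \<Sum>\<^sub>j a\<^sup>j z\<^sub>j\<close>, where \<open>z\<close> is the previous remainder.
\<close>

lemma resolvent_numerators_solve:
  fixes a :: real
  assumes "k < 60" and ijl: "nbr_list ! k = (i, j, l)"
  defines "f \<equiv> \<lambda>ds. column_value (tl (resolvent_numerators ds)) a"
  shows "ds \<noteq> [] \<Longrightarrow> (3 + a) * f ds k - (f ds i + f ds j + f ds l)
       = of_bool (k = 0) * horner_sum of_int a ds - of_int (hd (resolvent_numerators ds) ! k)"
proof (induction ds)
  case (Cons d ds)
  have root: "source_list d ! k = of_bool (k = 0) * d"
    using \<open>k < 60\<close> by (auto simp: source_list_def nth_Cons')
  show ?case
  proof (cases ds)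
    case Nil
    then show ?thesis by (simp add: f_def root)
  next
    case (Cons d' ds')
    then obtain z zs where zs: "resolvent_numerators ds = z # zs"
      using resolvent_numerators_eq_Nil by (meson list.exhaust list.simps(3))
    have len: "length z = 60"
      using length_resolvent_numerators[of z ds] zs by simp
    have hd: "hd (resolvent_numerators (d # ds)) ! k
        = of_bool (k = 0) * d + (z ! i + z ! j + z ! l - 3 * z ! k)"
      using \<open>k < 60\<close> ijl root by (simp add: zs neg_laplacian_def length_lists len source_list_def)
    have f: "f (d # ds) m = of_int (z ! m) + a * f ds m" for m
      by (simp add: f_def zs)
    have "(3 + a) * f (d # ds) k - (f (d # ds) i + f (d # ds) j + f (d # ds) l)
       = (3 + a) * z ! k - (z ! i + z ! j + z ! l) + a * ((3 + a) * f ds k - (f ds i + f ds j + f ds l))"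
      by (simp add: f algebra_simps)
    also have "(3 + a) * f ds k - (f ds i + f ds j + f ds l)
       = of_bool (k = 0) * horner_sum of_int a ds - of_int (z ! k)"
      using Cons.IH Cons zs by simp
    finally show ?thesis
      unfolding hd by (simp add: algebra_simps)
  qed
qed simp

lemma den_coeffs_nonempty: "den_coeffs \<noteq> []"
  by (simp add: den_coeffs_def)

lemma best_den_horner: "horner_sum of_int a den_coeffs = best_den a"
  by (simp add: den_coeffs_def best_den_def algebra_simps power_numeral_reduce)

lemma best_num_horner: "horner_sum of_int a num_coeffs = best_num a"
  by (simp add: num_coeffs_def best_num_def algebra_simps power_numeral_reduce)

lemma best_den_pos: "0 < a \<Longrightarrow> 0 < best_den a"
  unfolding best_den_def by (intro mult_pos_pos add_pos_nonneg add_nonneg_nonneg) auto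

lemma best_const_pos: "0 < a \<Longrightarrow> 0 < best_const a"
proof -
  assume a: "0 < a"
  then have "0 < best_num a"
    unfolding best_num_def by (intro add_pos_nonneg) auto
  then show ?thesis using best_den_pos[OF a] by (simp add: best_const_def)
qed

text \<open>
  The diagonal entry at \<open>q\<close> of the Green matrix is \<open>best_num a / best_den a\<close>, expressed without
  division and without matrices: the Poisson equation with a source of strength \<open>best_den a\<close> at \<open>q\<close>
  has a solution with value \<open>best_num a\<close> at \<open>q\<close>. In this form the property is visibly invariant
  under graph automorphisms.
\<close>

definition point_source_solvable :: "real \<Rightarrow> nat \<times> nat \<Rightarrow> bool" where
  "point_source_solvable a q \<longleftrightarrow> (\<exists>f. f q = best_num a \<and>
     (\<forall>p\<in>buckyball_vertices. shifted_vertex_laplacian a f p = (if p = q then best_den a else 0)))"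

lemma point_source_solvable_0_1: "point_source_solvable a (0, 1)"
proof -
  define R where "R = resolvent_numerators den_coeffs"
  define index where "index = inv_into {..<60} ((!) vertex_list)"
  define f where "f = column_value (tl R) a \<circ> index"
  have inj: "inj_on ((!) vertex_list) {..<60}"
    using distinct_vertex_list by (simp add: inj_on_nth length_lists)
  then have f: "f (vertex_list ! k) = column_value (tl R) a k" if "k < 60" for k
    using that by (simp add: f_def index_def)
  have root: "vertex_list ! 0 = (0, 1)"
    by (simp add: vertex_list_def)
  have "shifted_vertex_laplacian a f p = (if p = (0, 1) then best_den a else 0)" if "p \<in> buckyball_vertices" for p
  proof -
    have "p \<in> set vertex_list"
      using that by (simp add: set_vertex_list)
    then obtain k where k: "k < 60" "p = vertex_list ! k"
      by (auto simp: in_set_conv_nth length_lists)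
    obtain i j l where ijl: "nbr_list ! k = (i, j, l)"
      by (metis prod_cases3)
    have N: "{q. buckyball_adj p q} = {vertex_list ! i, vertex_list ! j, vertex_list ! l}"
      and "distinct [i, j, l]" and lt: "i < 60" "j < 60" "l < 60"
      using nbr_list_correct k ijl by fastforce+
    then have "distinct [vertex_list ! i, vertex_list ! j, vertex_list ! l]"
      using inj by (auto dest: inj_onD)
    then have "shifted_vertex_laplacian a f p = (3 + a) * column_value (tl R) a k
        - (column_value (tl R) a i + column_value (tl R) a j + column_value (tl R) a l)"
      unfolding shifted_vertex_laplacian_def N using k lt by (simp add: f)
    also have "\<dots> = (if k = 0 then best_den a else 0)"
      using resolvent_numerators_solve[OF k(1) ijl, of den_coeffs a] k(1) resolvent_numerators_den_coeffs(1)
      by (simp add: R_def best_den_horner den_coeffs_nonempty)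
    also have "k = 0 \<longleftrightarrow> p = (0, 1)"
      using k root inj_onD[OF inj, of k 0] by auto
    finally show ?thesis .
  qed
  moreover have "f (0, 1) = best_num a"
  proof -
    have "map (\<lambda>z. z ! 0) (tl R) = map hd (tl R)"
      using length_resolvent_numerators[of _ den_coeffs]
      by (intro map_cong refl hd_conv_nth[symmetric])
        (metis R_def list.set_sel(2) list.size(3) tl_Nil zero_neq_numeral list.set_cases empty_iff empty_set)
    then have "column_value (tl R) a 0 = best_num a"
      using resolvent_numerators_den_coeffs(2) by (simp add: column_value_def R_def best_num_horner)
    then show ?thesis using f[of 0] root by simp
  qed
  ultimately show ?thesis
    unfolding point_source_solvable_def by blast
qed

section \<open>Transitivity of the icosahedral reflections\<close>

definition icosahedral_reflection :: "(nat \<Rightarrow> nat) \<Rightarrow> bool" where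
  "icosahedral_reflection r \<longleftrightarrow>
     (\<forall>v. r (r v) = v) \<and> (\<forall>v w. icosahedron_adj v w \<longrightarrow> icosahedron_adj (r v) (r w))"

lemma icosahedral_reflection_adj:
  assumes "icosahedral_reflection r"
  shows "icosahedron_adj (r v) (r w) \<longleftrightarrow> icosahedron_adj v w"
  using assms unfolding icosahedral_reflection_def by metis

text \<open>
  If \<open>f\<close> solves the equation with source \<open>q\<close> and \<open>s\<close> is an involutive automorphism of the
  buckyball, then \<open>f \<circ> s\<close> solves it with source \<open>s q\<close>.
\<close>

lemma point_source_solvable_reflect:
  assumes r: "icosahedral_reflection r" and "point_source_solvable a (v, w)"
  shows "point_source_solvable a (r v, r w)"
proof -
  define s where "s = map_prod r r"
  have ss: "s (s p) = p" for p
    using r by (cases p) (simp add: s_def icosahedral_reflection_def)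
  have vert: "s p \<in> buckyball_vertices \<longleftrightarrow> p \<in> buckyball_vertices" for p
    by (cases p) (simp add: s_def buckyball_vertices_def icosahedral_reflection_adj[OF r])
  have inj: "r x = r y \<longleftrightarrow> x = y" for x y
    using r unfolding icosahedral_reflection_def by metis
  have adj: "buckyball_adj (s p) (s q) \<longleftrightarrow> buckyball_adj p q" for p q
    using vert[of p] vert[of q]
    by (cases p; cases q) (simp add: buckyball_adj_def s_def icosahedral_reflection_adj[OF r] inj)
  obtain f where f: "f (v, w) = best_num a"
    "\<And>p. p \<in> buckyball_vertices \<Longrightarrow> shifted_vertex_laplacian a f p = (if p = (v, w) then best_den a else 0)"
    using assms(2) by (auto simp: point_source_solvable_def)
  have "shifted_vertex_laplacian a (f \<circ> s) p = shifted_vertex_laplacian a f (s p)" for p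
  proof -
    have "(\<Sum>q | buckyball_adj p q. f (s q)) = (\<Sum>q | buckyball_adj (s p) q. f q)"
      by (rule sum.reindex_bij_witness[of _ s s]) (auto simp: ss adj, metis adj ss)
    then show ?thesis by (simp add: shifted_vertex_laplacian_def)
  qed
  moreover have image: "s p = (v, w) \<longleftrightarrow> p = (r v, r w)" for p
    by (metis map_prod_simp s_def ss)
  ultimately have "\<forall>p\<in>buckyball_vertices.
      shifted_vertex_laplacian a (f \<circ> s) p = (if p = (r v, r w) then best_den a else 0)"
    using f(2) vert by simp
  moreover have "(f \<circ> s) (r v, r w) = best_num a"
    using iffD2[OF image refl] f(1) by simp
  ultimately show ?thesis unfolding point_source_solvable_def by blast
qed

text \<open>
  Three mirror symmetries. The mirrors of the first two contain the axis through the poles 0 and 11,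
  so that their product is a rotation by a fifth turn about that axis; the third one
  exchanges the pole 0 with its neighbour 1.
\<close>

definition reflection1 :: "nat \<Rightarrow> nat" where
  "reflection1 = id(2 := 5, 5 := 2, 3 := 4, 4 := 3, 6 := 7, 7 := 6, 8 := 10, 10 := 8)"
definition reflection2 :: "nat \<Rightarrow> nat" where
  "reflection2 = id(1 := 2, 2 := 1, 3 := 5, 5 := 3, 6 := 8, 8 := 6, 9 := 10, 10 := 9)"
definition reflection3 :: "nat \<Rightarrow> nat" where
  "reflection3 = id(0 := 1, 1 := 0, 3 := 7, 7 := 3, 4 := 6, 6 := 4, 9 := 11, 11 := 9)"

lemmas reflection_defs = reflection1_def reflection2_def reflection3_def

text \<open>
  Preservation of the set of edges is a statement about 30 explicit edges, which the value tables
  below decide by rewriting.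
\<close>

lemma icosahedral_reflectionI:
  assumes "\<And>v. r (r v) = v" and "\<forall>e\<in>icosahedron_edges. r ` e \<in> icosahedron_edges"
  shows "icosahedral_reflection r"
  using assms by (force simp: icosahedral_reflection_def icosahedron_adj_def)

lemma reflection1_table:
    "reflection1 0 = 0" "reflection1 1 = 1" "reflection1 2 = 5" "reflection1 3 = 4"
    "reflection1 4 = 3" "reflection1 5 = 2" "reflection1 6 = 7" "reflection1 7 = 6"
    "reflection1 8 = 10" "reflection1 9 = 9" "reflection1 10 = 8" "reflection1 11 = 11"
  by (simp_all add: reflection1_def)

lemma reflection2_table:
    "reflection2 0 = 0" "reflection2 1 = 2" "reflection2 2 = 1" "reflection2 3 = 5"
    "reflection2 4 = 4" "reflection2 5 = 3" "reflection2 6 = 8" "reflection2 7 = 7"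
    "reflection2 8 = 6" "reflection2 9 = 10" "reflection2 10 = 9" "reflection2 11 = 11"
  by (simp_all add: reflection2_def)

lemma reflection3_table:
    "reflection3 0 = 1" "reflection3 1 = 0" "reflection3 2 = 2" "reflection3 3 = 7"
    "reflection3 4 = 6" "reflection3 5 = 5" "reflection3 6 = 4" "reflection3 7 = 3"
    "reflection3 8 = 8" "reflection3 9 = 11" "reflection3 10 = 10" "reflection3 11 = 9"
  by (simp_all add: reflection3_def)

lemma reflections:
  "icosahedral_reflection reflection1" "icosahedral_reflection reflection2"
  "icosahedral_reflection reflection3"
proof -
  have "\<forall>e\<in>icosahedron_edges. reflection1 ` e \<in> icosahedron_edges"
    by (simp add: reflection1_table icosahedron_edges_def doubleton_eq_iff del: One_nat_def)
  then show "icosahedral_reflection reflection1"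
    by (rule icosahedral_reflectionI[rotated]) (simp add: reflection1_def)
  have "\<forall>e\<in>icosahedron_edges. reflection2 ` e \<in> icosahedron_edges"
    by (simp add: reflection2_table icosahedron_edges_def doubleton_eq_iff del: One_nat_def)
  then show "icosahedral_reflection reflection2"
    by (rule icosahedral_reflectionI[rotated]) (simp add: reflection2_def)
  have "\<forall>e\<in>icosahedron_edges. reflection3 ` e \<in> icosahedron_edges"
    by (simp add: reflection3_table icosahedron_edges_def doubleton_eq_iff del: One_nat_def)
  then show "icosahedral_reflection reflection3"
    by (rule icosahedral_reflectionI[rotated]) (simp add: reflection3_def)
qed

text \<open>
  The reflections generate a group that is transitive on the ordered pairs of adjacent vertices of
  the icosahedron. The first two move \<open>(0, 1)\<close> to all pairs that start at the pole 0. That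
  the equation is solvable for all sources with first component \<open>v\<close> is again an invariant property
  of \<open>v\<close>, and all three reflections carry it from the pole to the remaining eleven vertices.
\<close>

lemma point_source_solvable_all:
  assumes "p \<in> buckyball_vertices"
  shows "point_source_solvable a p"
proof -
  define S where "S = {v. \<forall>w. icosahedron_adj v w \<longrightarrow> point_source_solvable a (v, w)}"
  have S: "r v \<in> S" if r: "icosahedral_reflection r" and "v \<in> S" for r v
  proof -
    have "point_source_solvable a (r v, w)" if "icosahedron_adj (r v) w" for w
    proof -
      have "r (r w) = w" using r by (simp add: icosahedral_reflection_def)
      then have "icosahedron_adj v (r w)"
        using icosahedral_reflection_adj[OF r, of v "r w"] that by simp
      then have "point_source_solvable a (v, r w)" using \<open>v \<in> S\<close> by (simp add: S_def)
      from point_source_solvable_reflect[OF r this] show ?thesis by (simp add: \<open>r (r w) = w\<close>)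
    qed
    then show ?thesis by (simp add: S_def)
  qed
  note R = point_source_solvable_reflect[OF reflections(1)] point_source_solvable_reflect[OF reflections(2)]
  have w1: "point_source_solvable a (0, 1)" by (rule point_source_solvable_0_1)
  have w2: "point_source_solvable a (0, 2)" using R(2)[OF w1] by (simp add: reflection_defs)
  have w5: "point_source_solvable a (0, 5)" using R(1)[OF w2] by (simp add: reflection_defs)
  have w3: "point_source_solvable a (0, 3)" using R(2)[OF w5] by (simp add: reflection_defs)
  have w4: "point_source_solvable a (0, 4)" using R(1)[OF w3] by (simp add: reflection_defs)
  have v0: "0 \<in> S"
    using w1 w2 w3 w4 w5 icosahedron_nbrs_table(1) by (auto simp: S_def icosahedron_nbrs_def set_eq_iff)
  have v1: "1 \<in> S" using S[OF reflections(3) v0] by (simp add: reflection_defs)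
  have v2: "2 \<in> S" using S[OF reflections(2) v1] by (simp add: reflection_defs)
  have v5: "5 \<in> S" using S[OF reflections(1) v2] by (simp add: reflection_defs)
  have v3: "3 \<in> S" using S[OF reflections(2) v5] by (simp add: reflection_defs)
  have v4: "4 \<in> S" using S[OF reflections(1) v3] by (simp add: reflection_defs)
  have v6: "6 \<in> S" using S[OF reflections(3) v4] by (simp add: reflection_defs)
  have v7: "7 \<in> S" using S[OF reflections(3) v3] by (simp add: reflection_defs)
  have v8: "8 \<in> S" using S[OF reflections(2) v6] by (simp add: reflection_defs)
  have v10: "10 \<in> S" using S[OF reflections(1) v8] by (simp add: reflection_defs)
  have v9: "9 \<in> S" using S[OF reflections(2) v10] by (simp add: reflection_defs)
  have v11: "11 \<in> S" using S[OF reflections(3) v9] by (simp add: reflection_defs)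
  obtain v w where p: "p = (v, w)" "icosahedron_adj v w"
    using assms by (auto simp: buckyball_vertices_def)
  then have "v \<in> {..<12}" using icosahedron_adj_bound by auto
  also have "{..<12} = {0, 1, 2, 3, 4, 5, 6, 7, 8, 9, 10, 11 :: nat}"
    by (auto; presburger)
  finally have "v \<in> S" using v0 v1 v2 v3 v4 v5 v6 v7 v8 v9 v10 v11 by blast
  then show ?thesis using p by (simp add: S_def)
qed

section \<open>The energy as a quadratic form\<close>

text \<open>
  The Sobolev energy of a real function. The complex energy is the sum of the energies of the real
  and the imaginary part, so that the inequality only has to be proved over the reals.
\<close>

definition edge_form :: "(nat \<Rightarrow> nat \<times> nat) \<Rightarrow> real \<Rightarrow> (nat \<Rightarrow> real) \<Rightarrow> real" where
  "edge_form lab a x = (\<Sum>(i, j)\<in>buckyball_edges lab. (x i - x j)\<^sup>2) + a * (\<Sum>j<60. (x j)\<^sup>2)"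

lemma sobolev_energy_Re_Im:
  "sobolev_energy lab a u = edge_form lab a (\<lambda>i. Re (u $ i)) + edge_form lab a (\<lambda>i. Im (u $ i))"
proof -
  have "{0..59} = {..<60::nat}" by auto
  then show ?thesis
    by (simp add: sobolev_energy_def edge_form_def cmod_power2 sum.distrib case_prod_unfold distrib_left)
qed

lemma edge_form_cong:
  assumes "\<And>i. i < 60 \<Longrightarrow> x i = y i"
  shows "edge_form lab a x = edge_form lab a y"
  unfolding edge_form_def using assms
  by (intro arg_cong2[of _ _ _ _ "(+)"] arg_cong2[of _ _ _ _ "(*)"] sum.cong refl)
    (auto simp: buckyball_edges_def)

lemma sobolev_energy_of_real:
  assumes "dim_vec x = 60"
  shows "sobolev_energy lab a (map_vec complex_of_real x) = edge_form lab a (($) x)"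
proof -
  have "edge_form lab a (\<lambda>i. Re (map_vec complex_of_real x $ i)) = edge_form lab a (($) x)"
    by (rule edge_form_cong) (simp add: assms)
  moreover have "edge_form lab a (\<lambda>i. Im (map_vec complex_of_real x $ i)) = edge_form lab a (\<lambda>_. 0)"
    by (rule edge_form_cong) (simp add: assms)
  ultimately show ?thesis
    by (simp add: sobolev_energy_Re_Im edge_form_def)
qed

lemma edge_form_nonneg: "0 \<le> a \<Longrightarrow> 0 \<le> edge_form lab a x"
  unfolding edge_form_def by (intro add_nonneg_nonneg mult_nonneg_nonneg sum_nonneg) auto

lemma edge_form_pos: "0 < a \<Longrightarrow> j < 60 \<Longrightarrow> x j \<noteq> 0 \<Longrightarrow> 0 < edge_form lab a x"
  unfolding edge_form_def
  by (intro add_nonneg_pos mult_pos_pos sum_nonneg sum_pos2[of _ j]) auto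

context
  fixes lab :: "nat \<Rightarrow> nat \<times> nat" and a :: real
  assumes lab: "buckyball_labeling lab"
begin

definition nbr_labels :: "nat \<Rightarrow> nat set" where
  "nbr_labels i = {j. j < 60 \<and> buckyball_adj (lab i) (lab j)}"

lemma bij_lab: "bij_betw lab {..<60} buckyball_vertices"
proof -
  have "{0..59} = {..<60::nat}" by auto
  then show ?thesis using lab by (simp add: buckyball_labeling_def)
qed

lemma sum_nbr_labels: "(\<Sum>j\<in>nbr_labels i. f (lab j)) = (\<Sum>q | buckyball_adj (lab i) q. f q)"
proof (rule sum.reindex_bij_betw)
  have "lab ` nbr_labels i = {q. buckyball_adj (lab i) q}"
  proof -
    have "q \<in> lab ` {..<60}" if "buckyball_adj (lab i) q" for q
      using that bij_lab by (simp add: buckyball_adj_def bij_betw_def)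
    then show ?thesis unfolding nbr_labels_def lessThan_def by blast
  qed
  moreover have "inj_on lab (nbr_labels i)"
    using bij_lab by (auto simp: nbr_labels_def bij_betw_def intro: inj_on_subset)
  ultimately show "bij_betw lab (nbr_labels i) {q. buckyball_adj (lab i) q}"
    by (simp add: bij_betw_def)
qed

lemma Int_nbr_labels: "{..<60} \<inter> nbr_labels i = nbr_labels i"
  by (auto simp: nbr_labels_def)

lemma finite_nbr_labels: "finite (nbr_labels i)"
  by (simp add: nbr_labels_def)

lemma card_nbr_labels:
  assumes "i < 60"
  shows "card (nbr_labels i) = 3"
proof -
  have "lab i \<in> set vertex_list"
    using bij_lab assms by (auto simp: set_vertex_list bij_betw_def)
  then obtain k where k: "k < 60" "lab i = vertex_list ! k"
    by (auto simp: in_set_conv_nth length_lists)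
  obtain j l m where t: "nbr_list ! k = (j, l, m)"
    by (metis prod_cases3)
  have N: "{q. buckyball_adj (lab i) q} = {vertex_list ! j, vertex_list ! l, vertex_list ! m}"
    and d: "distinct [j, l, m]" "j < 60" "l < 60" "m < 60"
    using nbr_list_correct k t by fastforce+
  have "distinct [vertex_list ! j, vertex_list ! l, vertex_list ! m]"
    using d distinct_vertex_list by (simp add: nth_eq_iff_index_eq length_lists)
  then have "card {q. buckyball_adj (lab i) q} = 3"
    by (simp add: N)
  then show ?thesis
    using sum_nbr_labels[of "\<lambda>_. 1::nat" i] by simp
qed

lemma nbr_labels_sym: "i < 60 \<Longrightarrow> j < 60 \<Longrightarrow> j \<in> nbr_labels i \<longleftrightarrow> i \<in> nbr_labels j"
  using buckyball_adj_sym by (auto simp: nbr_labels_def)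

lemma sum_nbr_labels_swap:
  "(\<Sum>i<60. \<Sum>j\<in>nbr_labels i. g i j) = (\<Sum>i<60. \<Sum>j\<in>nbr_labels i. g j i)" for g :: "nat \<Rightarrow> nat \<Rightarrow> real"
proof -
  have "(\<Sum>i<60. \<Sum>j\<in>nbr_labels i. g i j) = (\<Sum>i<60. \<Sum>j<60. if j \<in> nbr_labels i then g i j else 0)"
    by (rule sum.cong[OF refl]) (simp add: sum.inter_restrict[symmetric] Int_nbr_labels)
  also have "\<dots> = (\<Sum>j<60. \<Sum>i<60. if j \<in> nbr_labels i then g i j else 0)"
    by (rule sum.swap)
  also have "\<dots> = (\<Sum>j<60. \<Sum>i<60. if i \<in> nbr_labels j then g i j else 0)"
    by (intro sum.cong refl) (simp add: nbr_labels_sym)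
  also have "\<dots> = (\<Sum>i<60. \<Sum>j\<in>nbr_labels i. g j i)"
    by (rule sum.cong[OF refl]) (simp add: sum.inter_restrict[symmetric] Int_nbr_labels)
  finally show ?thesis .
qed

text \<open>
  Each edge is represented by its increasing pair of labels, while the sum over neighbours meets it
  from both ends.
\<close>

lemma sum_edges:
  fixes g :: "nat \<Rightarrow> nat \<Rightarrow> real"
  assumes "\<And>i j. g i j = g j i"
  shows "2 * (\<Sum>(i, j)\<in>buckyball_edges lab. g i j) = (\<Sum>i<60. \<Sum>j\<in>nbr_labels i. g i j)"
proof -
  let ?E = "buckyball_edges lab"
  have fin: "finite ?E"
    by (rule finite_subset[of _ "{..<60} \<times> {..<60}"]) (auto simp: buckyball_edges_def)
  have "(\<Sum>(i, j)\<in>prod.swap ` ?E. g i j) = (\<Sum>(i, j)\<in>?E. g i j)"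
    by (subst sum.reindex) (auto simp: assms case_prod_unfold)
  moreover have "?E \<inter> prod.swap ` ?E = {}"
    by (auto simp: buckyball_edges_def)
  moreover have "Sigma {..<60} nbr_labels = ?E \<union> prod.swap ` ?E"
  proof -
    have "(i, j) \<in> Sigma {..<60} nbr_labels \<longleftrightarrow> (i, j) \<in> ?E \<or> (j, i) \<in> ?E" for i j
      using buckyball_adj_sym[of "lab i" "lab j"] buckyball_adj_irrefl[of "lab i"]
      by (cases i j rule: linorder_cases) (auto simp: buckyball_edges_def nbr_labels_def)
    then show ?thesis by force
  qed
  ultimately have "(\<Sum>(i, j)\<in>Sigma {..<60} nbr_labels. g i j) = 2 * (\<Sum>(i, j)\<in>?E. g i j)"
    using fin by (simp add: sum.union_disjoint)
  then show ?thesis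
    by (simp add: sum.Sigma finite_nbr_labels)
qed

abbreviation "M \<equiv> shifted_laplacian lab a"

lemma laplacian_carrier: "laplacian lab \<in> carrier_mat 60 60"
  by (simp add: laplacian_def)

lemma M_carrier: "M \<in> carrier_mat 60 60"
  by (simp add: shifted_laplacian_def laplacian_carrier)

lemma laplacian_entry:
  "i < 60 \<Longrightarrow> j < 60 \<Longrightarrow> laplacian lab $$ (i, j) = (if i = j then 3 else if j \<in> nbr_labels i then - 1 else 0)"
  using buckyball_adj_sym by (auto simp: laplacian_def buckyball_edges_def nbr_labels_def)

lemma laplacian_symmetric:
  "i < 60 \<Longrightarrow> j < 60 \<Longrightarrow> laplacian lab $$ (i, j) = laplacian lab $$ (j, i)"
  using nbr_labels_sym by (simp add: laplacian_entry)

lemma transpose_M: "transpose_mat M = M"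
  using laplacian_carrier laplacian_symmetric by (intro eq_matI) (auto simp: shifted_laplacian_def)

lemma self_adjoint_M:
  "x \<in> carrier_vec 60 \<Longrightarrow> y \<in> carrier_vec 60 \<Longrightarrow> (M *\<^sub>v x) \<bullet> y = x \<bullet> (M *\<^sub>v y)"
  using transpose_vec_mult_scalar[OF M_carrier, of y x] transpose_M M_carrier
  by (metis comm_scalar_prod mult_mat_vec_carrier)

lemma M_apply:
  assumes x: "x \<in> carrier_vec 60" and i: "i < 60"
  shows "(M *\<^sub>v x) $ i = (3 + a) * x $ i - (\<Sum>j\<in>nbr_labels i. x $ j)"
proof -
  have irr: "i \<notin> nbr_labels i" by (simp add: nbr_labels_def buckyball_adj_irrefl)
  have "(M *\<^sub>v x) $ i = (\<Sum>j<60. M $$ (i, j) * x $ j)"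
    using M_carrier x i by (simp add: scalar_prod_def atLeast0LessThan)
  also have "\<dots> = (\<Sum>j<60. (if j = i then (3 + a) * x $ j else 0) - (if j \<in> nbr_labels i then x $ j else 0))"
    using laplacian_carrier i irr
    by (intro sum.cong refl) (auto simp: shifted_laplacian_def laplacian_entry algebra_simps)
  also have "\<dots> = (3 + a) * x $ i - (\<Sum>j\<in>nbr_labels i. x $ j)"
    using i by (simp add: sum_subtractf sum.inter_restrict[symmetric] Int_nbr_labels)
  finally show ?thesis .
qed

lemma edge_form_eq_scalar_prod:
  assumes x: "x \<in> carrier_vec 60"
  shows "edge_form lab a (($) x) = x \<bullet> (M *\<^sub>v x)"
proof -
  define s where "s = (\<Sum>i<60. \<Sum>j\<in>nbr_labels i. x $ i * x $ j)"
  have sq: "(\<Sum>i<60. \<Sum>j\<in>nbr_labels i. (x $ i)\<^sup>2) = 3 * (\<Sum>i<60. (x $ i)\<^sup>2)"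
    by (simp add: sum_distrib_left card_nbr_labels)
  have "2 * (\<Sum>(i, j)\<in>buckyball_edges lab. (x $ i - x $ j)\<^sup>2)
      = (\<Sum>i<60. \<Sum>j\<in>nbr_labels i. (x $ i - x $ j)\<^sup>2)"
    by (rule sum_edges) (rule power2_commute)
  also have "\<dots> = (\<Sum>i<60. \<Sum>j\<in>nbr_labels i. (x $ i)\<^sup>2) + (\<Sum>i<60. \<Sum>j\<in>nbr_labels i. (x $ j)\<^sup>2) - 2 * s"
    by (simp add: s_def power2_diff sum.distrib sum_subtractf sum_distrib_left mult.assoc)
  also have "(\<Sum>i<60. \<Sum>j\<in>nbr_labels i. (x $ j)\<^sup>2) = (\<Sum>i<60. \<Sum>j\<in>nbr_labels i. (x $ i)\<^sup>2)"
    by (rule sum_nbr_labels_swap)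
  finally have "(\<Sum>(i, j)\<in>buckyball_edges lab. (x $ i - x $ j)\<^sup>2) = 3 * (\<Sum>i<60. (x $ i)\<^sup>2) - s"
    using sq by simp
  moreover have "x \<bullet> (M *\<^sub>v x) = (\<Sum>i<60. x $ i * (M *\<^sub>v x) $ i)"
    using M_carrier x by (simp add: scalar_prod_def atLeast0LessThan)
  moreover have "\<dots> = (3 + a) * (\<Sum>i<60. (x $ i)\<^sup>2) - s"
    using x
    by (simp add: M_apply s_def right_diff_distrib sum_subtractf sum_distrib_left power2_eq_square mult_ac)
  ultimately show ?thesis
    by (simp add: edge_form_def algebra_simps)
qed

section \<open>The Green matrix and the best constant\<close>

context
  assumes a: "0 < a"
begin

abbreviation "G \<equiv> green_matrix lab a"

text \<open>
  A kernel vector of \<open>M\<close> would have energy 0, which the term with the factor \<open>a > 0\<close> forbids.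
\<close>

lemma green_matrix_inverse: "M * G = 1\<^sub>m 60" "G * M = 1\<^sub>m 60" "G \<in> carrier_mat 60 60"
proof -
  have "det M \<noteq> 0"
  proof
    assume "det M = 0"
    then obtain v where v: "v \<in> carrier_vec 60" "v \<noteq> 0\<^sub>v 60" "M *\<^sub>v v = 0\<^sub>v 60"
      using det_0_iff_vec_prod_zero[OF M_carrier] by auto
    then obtain j where "j < 60" "v $ j \<noteq> 0"
      by (metis eq_vecI carrier_vecD index_zero_vec)
    then have "0 < edge_form lab a (($) v)"
      using edge_form_pos[OF a] by simp
    then show False
      using v by (simp add: edge_form_eq_scalar_prod)
  qed
  then have "M \<in> Units (ring_mat TYPE(real) 60 ())"
    by (rule det_non_zero_imp_unit[OF M_carrier])
  then obtain B where "mat_inverse M = Some B"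
    using mat_inverse(1)[OF M_carrier] by fastforce
  then show "M * G = 1\<^sub>m 60" "G * M = 1\<^sub>m 60" "G \<in> carrier_mat 60 60"
    using mat_inverse(2)[OF M_carrier] by (simp_all add: green_matrix_def)
qed

lemma M_col_green: "k < 60 \<Longrightarrow> M *\<^sub>v col G k = unit_vec 60 k"
  using col_mult2[OF M_carrier green_matrix_inverse(3), of k] green_matrix_inverse(1) by simp

text \<open>
  Inverting \<open>M x = best_den a \<cdot> e\<^sub>k\<close>, where \<open>x\<close> is the explicit solution with source \<open>lab k\<close>, shows
  that \<open>x\<close> is \<open>best_den a\<close> times the \<open>k\<close>-th column of the Green matrix.
\<close>

lemma green_diagonal:
  assumes k: "k < 60"
  shows "G $$ (k, k) = best_const a"
proof -
  note G = green_matrix_inverse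
  have "lab k \<in> buckyball_vertices"
    using bij_lab k by (auto simp: bij_betw_def)
  then have "point_source_solvable a (lab k)"
    by (rule point_source_solvable_all)
  then obtain f where f: "f (lab k) = best_num a"
    "\<And>p. p \<in> buckyball_vertices \<Longrightarrow> shifted_vertex_laplacian a f p = (if p = lab k then best_den a else 0)"
    by (auto simp: point_source_solvable_def)
  define x where "x = vec 60 (\<lambda>i. f (lab i))"
  have x: "x \<in> carrier_vec 60" by (simp add: x_def)
  have "M *\<^sub>v x = best_den a \<cdot>\<^sub>v unit_vec 60 k"
  proof (rule eq_vecI)
    fix i assume "i < dim_vec (best_den a \<cdot>\<^sub>v unit_vec 60 k)"
    then have i: "i < 60" by simp
    have xi: "x $ i = f (lab i)" using i by (simp add: x_def)
    have "(\<Sum>j\<in>nbr_labels i. x $ j) = (\<Sum>j\<in>nbr_labels i. f (lab j))"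
      by (intro sum.cong) (auto simp: x_def nbr_labels_def)
    then have "(M *\<^sub>v x) $ i = shifted_vertex_laplacian a f (lab i)"
      by (simp add: M_apply[OF x i] shifted_vertex_laplacian_def sum_nbr_labels xi)
    also have "\<dots> = (if i = k then best_den a else 0)"
      using f(2)[of "lab i"] bij_betwE[OF bij_lab] inj_on_eq_iff[OF bij_betw_imp_inj_on[OF bij_lab]] i k
      by simp
    finally show "(M *\<^sub>v x) $ i = (best_den a \<cdot>\<^sub>v unit_vec 60 k) $ i"
      using i k by simp
  qed (use M_carrier in simp)
  then have "G *\<^sub>v (M *\<^sub>v x) = best_den a \<cdot>\<^sub>v (G *\<^sub>v unit_vec 60 k)"
    using G(3) by (simp add: mult_mat_vec)
  moreover have "G *\<^sub>v (M *\<^sub>v x) = x"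
    using G x by (simp add: assoc_mult_mat_vec[OF G(3) M_carrier x, symmetric])
  ultimately have "x $ k = best_den a * (G *\<^sub>v unit_vec 60 k) $ k"
    using G(3) k by simp
  also have "(G *\<^sub>v unit_vec 60 k) $ k = G $$ (k, k)"
    using G(3) k by (simp add: scalar_prod_right_unit[of _ 60])
  finally show ?thesis
    using f(1) k best_den_pos[OF a] by (simp add: x_def best_const_def field_simps)
qed

lemma col_green_carrier: "col G k \<in> carrier_vec 60"
  using green_matrix_inverse(3) by (intro carrier_vecI) simp

lemma scalar_prod_M_col_green:
  assumes "x \<in> carrier_vec 60" "k < 60"
  shows "x \<bullet> (M *\<^sub>v col G k) = x $ k"
  using assms by (simp add: M_col_green)

lemma col_green_diag: "k < 60 \<Longrightarrow> col G k $ k = best_const a"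
  using green_matrix_inverse(3) green_diagonal by simp

lemma edge_form_col_green: "k < 60 \<Longrightarrow> edge_form lab a (($) (col G k)) = best_const a"
  by (simp add: edge_form_eq_scalar_prod[OF col_green_carrier] scalar_prod_M_col_green col_green_carrier
      col_green_diag)

text \<open>
  The Green matrix is the reproducing kernel of the energy: \<open>\<langle>x, M g\<rangle> = x $ k\<close> for its \<open>k\<close>-th
  column \<open>g\<close>. With \<open>c = best_const a\<close>, the energy of \<open>g\<close>, the vector \<open>y = x - (x $ k / c) g\<close> is the
  component of \<open>x\<close> orthogonal to \<open>g\<close>, and Pythagoras gives that the energy of \<open>x\<close> exceeds
  \<open>(x $ k)\<^sup>2 / c\<close> by the energy of \<open>y\<close>.
\<close>

lemma real_sobolev:
  assumes x: "x \<in> carrier_vec 60" and k: "k < 60"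
  shows "(x $ k)\<^sup>2 \<le> best_const a * edge_form lab a (($) x)"
proof -
  define g where "g = col G k"
  define c where "c = best_const a"
  define t where "t = x $ k / c"
  have c: "0 < c" using best_const_pos[OF a] by (simp add: c_def)
  have g: "g \<in> carrier_vec 60" by (simp add: g_def col_green_carrier)
  define y where "y = x - t \<cdot>\<^sub>v g"
  have y: "y \<in> carrier_vec 60" using x g by (simp add: y_def)
  have Mx: "M *\<^sub>v x \<in> carrier_vec 60" and Mg: "M *\<^sub>v g \<in> carrier_vec 60"
    using mult_mat_vec_carrier[OF M_carrier] x g by blast+
  have gMx: "g \<bullet> (M *\<^sub>v x) = x $ k"
    using self_adjoint_M[OF g x] comm_scalar_prod[OF Mg x] scalar_prod_M_col_green[OF x k]
    by (simp add: g_def)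
  \<comment> \<open>The choice of \<open>t\<close> makes \<open>y\<close> vanish at \<open>k\<close>, that is, orthogonal to \<open>g\<close>.\<close>
  have yMg: "y \<bullet> (M *\<^sub>v g) = 0"
  proof -
    have "g $ k = c" using k by (simp only: g_def c_def col_green_diag)
    then have "y $ k = 0" using x g k c by (simp add: y_def t_def)
    then show ?thesis using scalar_prod_M_col_green[OF y k] by (simp add: g_def)
  qed
  have "0 \<le> y \<bullet> (M *\<^sub>v y)"
    using edge_form_nonneg[of a lab "($) y"] a y by (simp add: edge_form_eq_scalar_prod)
  also have "M *\<^sub>v y = M *\<^sub>v x - t \<cdot>\<^sub>v (M *\<^sub>v g)"
    using M_carrier x g by (simp add: y_def mult_minus_distrib_mat_vec[of _ 60 60] mult_mat_vec)
  also have "y \<bullet> \<dots> = y \<bullet> (M *\<^sub>v x)"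
    using scalar_prod_minus_distrib[OF y Mx, of "t \<cdot>\<^sub>v (M *\<^sub>v g)"] Mg y yMg by simp
  also have "\<dots> = x \<bullet> (M *\<^sub>v x) - t * x $ k"
    using minus_scalar_prod_distrib[OF x _ Mx, of "t \<cdot>\<^sub>v g"] g Mx gMx by (simp add: y_def)
  finally have "t * x $ k \<le> edge_form lab a (($) x)"
    using x by (simp add: edge_form_eq_scalar_prod)
  then show ?thesis
    using c by (simp add: t_def c_def power2_eq_square field_simps)
qed

lemma sobolev_pointwise:
  assumes u: "u \<in> carrier_vec 60" and k: "k < 60"
  shows "(cmod (u $ k))\<^sup>2 \<le> best_const a * sobolev_energy lab a u"
proof -
  have form: "edge_form lab a (($) (vec 60 f)) = edge_form lab a f" for f
    by (rule edge_form_cong) simp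
  show ?thesis
    using real_sobolev[of "vec 60 (\<lambda>i. Re (u $ i))" k] real_sobolev[of "vec 60 (\<lambda>i. Im (u $ i))" k] k
    by (simp add: form sobolev_energy_Re_Im cmod_power2 distrib_left)
qed

lemma sobolev_inequality_best_const: "sobolev_inequality lab a (best_const a)"
  unfolding sobolev_inequality_def
proof
  fix u :: "complex vec" assume u: "u \<in> carrier_vec 60"
  have "max_modulus u \<in> (\<lambda>j. cmod (u $ j)) ` {0..59}"
    unfolding max_modulus_def by (intro Max_in) auto
  then obtain j where "j \<le> 59" "max_modulus u = cmod (u $ j)" by auto
  then show "(max_modulus u)\<^sup>2 \<le> best_const a * sobolev_energy lab a u"
    using sobolev_pointwise[OF u, of j] by simp
qed

text \<open>
  A column of the Green matrix has energy equal to its diagonal entry. The inequality then bounds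
  all its entries by the diagonal one, which is therefore its maximum, and equality follows.
\<close>

lemma col_green_extremal:
  assumes k: "k < 60"
  defines "u \<equiv> map_vec complex_of_real (col G k)"
  shows "sobolev_energy lab a u = best_const a" "max_modulus u = best_const a"
proof -
  have dim: "dim_vec (col G k) = 60" using col_green_carrier by (rule carrier_vecD)
  show E: "sobolev_energy lab a u = best_const a"
    unfolding u_def sobolev_energy_of_real[OF dim] using k by (rule edge_form_col_green)
  have u: "u \<in> carrier_vec 60" using col_green_carrier[of k] by (simp add: u_def)
  show "max_modulus u = best_const a"
  proof (rule antisym)
    have "(max_modulus u)\<^sup>2 \<le> best_const a * sobolev_energy lab a u"
      using sobolev_inequality_best_const u by (simp add: sobolev_inequality_def)
    then have "(max_modulus u)\<^sup>2 \<le> (best_const a)\<^sup>2"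
      by (simp add: E power2_eq_square)
    then show "max_modulus u \<le> best_const a"
      using best_const_pos[OF a] by (simp add: power2_le_iff_abs_le)
    have "cmod (u $ k) \<le> max_modulus u"
      unfolding max_modulus_def using k by (intro Max_ge) auto
    then show "best_const a \<le> max_modulus u"
      using k dim best_const_pos[OF a] by (simp add: u_def col_green_diag)
  qed
qed

lemma best_const_least:
  assumes "sobolev_inequality lab a C"
  shows "best_const a \<le> C"
proof -
  define u where "u = map_vec complex_of_real (col G 0)"
  have "u \<in> carrier_vec 60"
    using col_green_carrier[of 0] by (simp add: u_def)
  then have "(max_modulus u)\<^sup>2 \<le> C * sobolev_energy lab a u"
    using assms by (simp add: sobolev_inequality_def)
  then have "(best_const a)\<^sup>2 \<le> C * best_const a"
    using col_green_extremal[of 0] by (simp add: u_def)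
  then show ?thesis
    using best_const_pos[OF a] by (simp add: power2_eq_square)
qed

lemma trace_green:
  assumes "char_poly (laplacian lab) = (\<Prod>e\<leftarrow>es. [:- e, 1:])"
  shows "60 * best_const a = (\<Sum>e\<leftarrow>es. 1 / (e + a))" "- a \<notin> set es"
  using trace_shifted_inverse[OF laplacian_carrier green_matrix_inverse(3) assms]
    green_matrix_inverse(1) green_diagonal by (simp_all add: shifted_laplacian_def)

end
end

section \<open>Eigenvalues of the Laplacian\<close>

text \<open>
  The multiplicity of the eigenvalue 0 is the residue at 0 of the trace of the resolvent.
\<close>

lemma tendsto_at_right_sum_resolvent:
  assumes "\<And>e. e \<in> set es \<Longrightarrow> 0 \<le> (e :: real)"
  shows "((\<lambda>a. a * (\<Sum>e\<leftarrow>es. 1 / (e + a))) \<longlongrightarrow> of_nat (count_list es 0)) (at_right 0)"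
  using assms
proof (induction es)
  case (Cons e es)
  have "((\<lambda>a. a * (1 / (e + a))) \<longlongrightarrow> (if e = 0 then 1 else 0)) (at_right 0)"
  proof (cases "e = 0")
    case True
    have "eventually (\<lambda>a::real. a * (1 / (e + a)) = 1) (at_right 0)"
      by (auto simp: True eventually_at_right_field intro!: exI[of _ 1])
    then show ?thesis using True by (simp add: tendsto_eventually)
  next
    case False
    then show ?thesis by (auto intro!: tendsto_eq_intros)
  qed
  from tendsto_add[OF this Cons.IH] Cons.prems show ?case
    by (simp add: distrib_left split: if_splits)
qed simp

text \<open>
  After the factor \<open>a\<close> of the denominator has been cancelled, the value at 0 is \<open>60 \<cdot> 3344 / 200640\<close>.
\<close>

lemma tendsto_best_const: "((\<lambda>a. a * (60 * best_const a)) \<longlongrightarrow> 1) (at_right 0)"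
proof -
  have "((\<lambda>a. 60 * best_num a / ((2 + a) * (5 + a) * (3 + 5 * a + a^2)
     * (8 + 7 * a + a^2) * (11 + 7 * a + a^2) * (19 + 9 * a + a^2) * (4 + 22 * a + 25 * a^2 + 9 * a^3 + a^4))) \<longlongrightarrow> 1) (at_right 0)"
    unfolding best_num_def by (auto intro!: tendsto_eq_intros)
  moreover have "eventually (\<lambda>a. 60 * best_num a / ((2 + a) * (5 + a) * (3 + 5 * a + a^2)
     * (8 + 7 * a + a^2) * (11 + 7 * a + a^2) * (19 + 9 * a + a^2) * (4 + 22 * a + 25 * a^2 + 9 * a^3 + a^4)) = a * (60 * best_const a)) (at_right 0)"
    unfolding eventually_at_right_field
    by (intro exI[of _ 1]) (simp add: best_const_def best_den_def)
  ultimately show ?thesis by (rule Lim_transform_eventually)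
qed

text \<open>
  No eigenvalue is negative, since \<open>A + a I\<close> is invertible for all \<open>a > 0\<close>. The trace of its inverse
  is \<open>60 \<cdot> best_const a\<close>, a rational function with residue 1 at 0; hence the eigenvalue 0 is simple.
\<close>

lemma laplacian_eigenvalues:
  assumes lab: "buckyball_labeling lab"
  defines "l \<equiv> eigenvalue_list (laplacian lab)"
  shows "char_poly (laplacian lab) = (\<Prod>e\<leftarrow>l. [:- e, 1:])" "length l = 60" "l ! 0 = 0" "0 < l ! 1"
proof -
  obtain es where es: "char_poly (laplacian lab) = (\<Prod>e\<leftarrow>es. [:- e, 1:])" "length es = 60"
    using symmetric_char_poly_splits[OF laplacian_carrier[OF lab] laplacian_symmetric[OF lab]] by blast
  have ms: "mset l = mset es"
    by (simp add: l_def eigenvalue_list_def es proots_prod_linear_factors)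
  have "sorted l" by (simp add: l_def eigenvalue_list_def)
  show poly: "char_poly (laplacian lab) = (\<Prod>e\<leftarrow>l. [:- e, 1:])"
    using ms es(1) by (metis mset_map prod_mset_prod_list)
  show len: "length l = 60" using ms es(2) by (metis size_mset)
  have nonneg: "0 \<le> e" if "e \<in> set l" for e
    using trace_green(2)[OF lab _ poly, of "- e"] that by force
  have "((\<lambda>a. a * (60 * best_const a)) \<longlongrightarrow> of_nat (count_list l 0)) (at_right 0)"
  proof (rule Lim_transform_eventually)
    show "eventually (\<lambda>a. a * (\<Sum>e\<leftarrow>l. 1 / (e + a)) = a * (60 * best_const a)) (at_right 0)"
      using trace_green(1)[OF lab _ poly]
      unfolding eventually_at_right_field by (intro exI[of _ 1]) auto
  qed (rule tendsto_at_right_sum_resolvent[OF nonneg])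
  then have "real (count_list l 0) = 1"
    using tendsto_best_const by (rule tendsto_unique[rotated]) simp
  then have one: "count_list l 0 = 1" by simp
  obtain e e' l' where l: "l = e # e' # l'"
    using len by (metis Suc_length_conv numeral_eq_Suc pred_numeral_simps)
  have "0 \<in> set l" using one by (metis count_notin zero_neq_one)
  then have "e = 0"
    using l \<open>sorted l\<close> nonneg[of e] by force
  then show "l ! 0 = 0" by (simp add: l)
  have "e' \<noteq> 0" using one l \<open>e = 0\<close> by auto
  then show "0 < l ! 1" using nonneg[of e'] l by simp
qed

section \<open>The best constant of the discrete Sobolev inequality\<close>

theorem theorem3p2:
  fixes lab :: "nat \<Rightarrow> nat \<times> nat" and a :: real
  assumes "buckyball_labeling lab" and "0 < a"
  shows
    "length (eigenvalue_list (laplacian lab)) = 60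
     \<and> eigenvalue_list (laplacian lab) ! 0 = 0
     \<and> 0 < eigenvalue_list (laplacian lab) ! 1
     \<and> green_matrix lab a \<in> carrier_mat 60 60
     \<and> inverts_mat (shifted_laplacian lab a) (green_matrix lab a)
     \<and> inverts_mat (green_matrix lab a) (shifted_laplacian lab a)
     \<and> (\<exists>C>0. sobolev_inequality lab a C)
     \<and> 0 < best_const a
     \<and> sobolev_inequality lab a (best_const a)
     \<and> (\<forall>C>0. sobolev_inequality lab a C \<longrightarrow> best_const a \<le> C)
     \<and> (\<forall>j\<le>59. green_matrix lab a $$ (j, j) = best_const a)
     \<and> best_const a = (1 / 60) * (\<Sum>j = 0..59. 1 / (eigenvalue_list (laplacian lab) ! j + a))
     \<and> (\<forall>k\<le>59. let u = map_vec complex_of_real (col (green_matrix lab a) k)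
                in (max_modulus u)\<^sup>2 = best_const a * sobolev_energy lab a u)"
proof -
  note G = green_matrix_inverse[OF assms] and ev = laplacian_eigenvalues[OF assms(1)]
  let ?l = "eigenvalue_list (laplacian lab)"
  have "(\<Sum>e\<leftarrow>?l. 1 / (e + a)) = (\<Sum>j = 0..59. 1 / (?l ! j + a))"
  proof -
    have "{0..59} = {0..<60::nat}" by auto
    then show ?thesis by (simp add: sum_list_sum_nth ev(2))
  qed
  then have mean: "best_const a = (1 / 60) * (\<Sum>j = 0..59. 1 / (?l ! j + a))"
    using trace_green(1)[OF assms ev(1)] by simp
  have extremal: "\<forall>k\<le>59. let u = map_vec complex_of_real (col (green_matrix lab a) k)
                in (max_modulus u)\<^sup>2 = best_const a * sobolev_energy lab a u"
    using col_green_extremal[OF assms] by (simp add: Let_def power2_eq_square)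
  have inverse: "inverts_mat (shifted_laplacian lab a) (green_matrix lab a)"
    "inverts_mat (green_matrix lab a) (shifted_laplacian lab a)"
    using G M_carrier[OF assms(1), of a] by (auto simp: inverts_mat_def)
  show ?thesis
  proof (intro conjI)
    show "\<exists>C>0. sobolev_inequality lab a C"
      using best_const_pos[OF assms(2)] sobolev_inequality_best_const[OF assms] by blast
    show "\<forall>C>0. sobolev_inequality lab a C \<longrightarrow> best_const a \<le> C"
      using best_const_least[OF assms] by blast
    show "\<forall>j\<le>59. green_matrix lab a $$ (j, j) = best_const a"
      using green_diagonal[OF assms] by simp
  qed (fact ev(2-4) G(3) inverse best_const_pos[OF assms(2)] sobolev_inequality_best_const[OF assms]
      mean extremal)+
qed

end
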